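(* For every positive integer $d$ there exists $N=N(d)$ such that for every integer $n\geq N$, every graph $\Gamma$ with vertex set $\{1,2,\dots,n\}$ and maximum degree at most $d$, and every prime $p>n^2$, every subset of size $n$ of $\mathbb{Z}_p\setminus\{0\}$ is $\Gamma$-sequenceable.
   Context: Let $\Gamma$ be a (simple) graph with vertex set $\{1,2,\dots,n\}$ and edge set $E(\Gamma)$. A subset $A$ of size $n$ of a group $G$ (written additively) is called $\Gamma$-sequenceable if there is an ordering $(v_1,\dots,v_n)$ of its elements such that the partial sums $s_0=0$ and $s_i=\sum_{j=1}^i v_j$ for $1\leq i\leq n$ satisfy $s_i\neq s_j$ whenever $\{i,j\}\in E(\Gamma)$. $\mathbb{Z}_p$ denotes the cyclic group of prime order $p$. *)

theory Defs
  imports "HOL-Algebra.Elementary_Groups" "HOL-Computational_Algebra.Primes"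
begin

definition simple_graph :: "'a set \<Rightarrow> 'a set set \<Rightarrow> bool" where
  "simple_graph V E \<longleftrightarrow> E \<subseteq> {e. e \<subseteq> V \<and> card e = 2}"

definition degree :: "'a set set \<Rightarrow> 'a \<Rightarrow> nat" where
  "degree E v = card {e \<in> E. v \<in> e}"

text \<open>Meaningful for finite nonempty \<open>V\<close> only.\<close>

definition max_degree :: "'a set \<Rightarrow> 'a set set \<Rightarrow> nat" where
  "max_degree V E = Max (degree E ` V)"

text \<open>
  The group operation is written multiplicatively, as in HOL-Algebra. The sum is the ordered
  one, so that the definition also makes sense for nonabelian groups.
\<close>

primrec partial_sum :: "('a, 'b) monoid_scheme \<Rightarrow> (nat \<Rightarrow> 'a) \<Rightarrow> nat \<Rightarrow> 'a" where
  "partial_sum G v 0 = \<one>\<^bsub>G\<^esub>"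
| "partial_sum G v (Suc i) = partial_sum G v i \<otimes>\<^bsub>G\<^esub> v (Suc i)"

text \<open>
  \<open>E\<close> is the edge set of a graph on the vertices \<open>{1..n}\<close>. The bijection \<open>v\<close> is the ordering;
  it forces \<open>A\<close> to have size \<open>n\<close>, and its values outside \<open>{1..n}\<close> are irrelevant.
\<close>

definition graph_sequenceable ::
  "('a, 'b) monoid_scheme \<Rightarrow> nat \<Rightarrow> nat set set \<Rightarrow> 'a set \<Rightarrow> bool" where
  "graph_sequenceable G n E A \<longleftrightarrow>
     A \<subseteq> carrier G \<and>
     (\<exists>v. bij_betw v {1..n} A \<and>
        (\<forall>i\<in>{1..n}. \<forall>j\<in>{1..n}. {i, j} \<in> E \<longrightarrow> partial_sum G v i \<noteq> partial_sum G v j))"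

end

theory Submission
  imports Defs Complex_Main "HOL.Binomial_Plus" "HOL-Algebra.FiniteProduct"
begin

text \<open>
  The argument works in every abelian group. Reserve a set of \<open>5 d + 1\<close> elements of \<open>A\<close> whose subset
  sums are pairwise distinct. The other elements are placed greedily from the left; each new partial
  sum has to avoid at most \<open>d\<close> values, those at its neighbours that are already placed and, if
  \<open>n\<close> is a neighbour, the sum of all of \<open>A\<close>. The last \<open>d\<close> of these elements
  are each placed right after a suitably chosen reserved element. What remains is a set \<open>R\<close> of
  \<open>m > 4 d\<close> reserved elements. Edges between the remaining positions cannot be
  violated, as distinct subsets of \<open>R\<close> have distinct sums. The other edges forbid, for each
  \<open>0 < k < m\<close>, at most \<open>d\<close> subsets of \<open>R\<close> as the set of the first \<open>k\<close> elements. A random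
  ordering of \<open>R\<close> meets a forbidden set with probability at most the sum of \<open>d / (m choose k)\<close>
  over \<open>k\<close>, which is below 1.
\<close>

section \<open>Weighted union bound over orderings and its binomial estimate\<close>

text \<open>A set \<open>F\<close> other than \<open>R\<close> avoids exactly
  \<open>card R - card F\<close> elements \<open>x\<close> of \<open>R\<close>, and this factor
  turns the weight of \<open>F\<close> in \<open>R - {x}\<close> into \<open>card R\<close> times
  its weight in \<open>R\<close>. So the average over \<open>x\<close> of the weights after removal
  is the original weight.\<close>

lemma sum_inverse_binomial_remove:
  fixes \<F> :: "'a set set"
  assumes "finite R" "R \<noteq> {}" "R \<notin> \<F>"
  shows "(\<Sum>x\<in>R. \<Sum>F\<in>{F\<in>\<F>. F \<subseteq> R - {x}}. 1 / real ((card R - 1) choose card F))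
       = real (card R) * (\<Sum>F\<in>{F\<in>\<F>. F \<subseteq> R}. 1 / real (card R choose card F))"
proof -
  let ?S = "{F\<in>\<F>. F \<subseteq> R}" and ?w = "\<lambda>F. 1 / real ((card R - 1) choose card F)"
  have fin: "finite ?S"
    using assms(1) by (rule_tac finite_subset[of _ "Pow R"]) auto
  have "(\<Sum>x\<in>R. \<Sum>F\<in>{F\<in>\<F>. F \<subseteq> R - {x}}. ?w F) = (\<Sum>x\<in>R. \<Sum>F\<in>?S. if x \<notin> F then ?w F else 0)"
    using fin by (intro sum.cong refl sum.mono_neutral_cong_left) auto
  also have "\<dots> = (\<Sum>F\<in>?S. \<Sum>x\<in>R. if x \<notin> F then ?w F else 0)"
    by (rule sum.swap)
  also have "\<dots> = (\<Sum>F\<in>?S. real (card R) * (1 / real (card R choose card F)))"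
  proof (rule sum.cong[OF refl])
    fix F assume F: "F \<in> ?S"
    then have "F \<subset> R" using assms(3) by auto
    then have lt: "card F < card R" by (simp add: assms(1) psubset_card_mono)
    obtain m where m: "card R = Suc m" using lt by (cases "card R") auto
    have "(Suc m - card F) * (Suc m choose card F) = Suc m * (m choose card F)"
      using binomial_absorb_comp[of "Suc m" "card F"] by simp
    then have eq: "real (Suc m - card F) * real (Suc m choose card F) = real (Suc m) * real (m choose card F)"
      by (metis of_nat_mult)
    have pos: "real (Suc m choose card F) > 0" "real (m choose card F) > 0"
      using lt m by auto
    have "(\<Sum>x\<in>R. if x \<notin> F then ?w F else 0) = (\<Sum>x\<in>R - F. ?w F)"
      using assms(1) by (intro sum.mono_neutral_cong_right) auto
    also have "\<dots> = real (Suc m - card F) / real (m choose card F)"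
      using F assms(1) m card_Diff_subset[of F R] finite_subset[of F R] by simp
    also have "\<dots> = real (card R) * (1 / real (card R choose card F))"
      using eq pos m by (simp add: field_simps)
    finally show "(\<Sum>x\<in>R. if x \<notin> F then ?w F else 0) = real (card R) * (1 / real (card R choose card F))" .
  qed
  finally show ?thesis by (simp add: sum_distrib_left)
qed

text \<open>Derandomized union bound over orderings of \<open>R\<close>: by averaging, some choice of the last
  element keeps the sum below 1.\<close>

lemma chain_avoiding_family:
  fixes \<F> :: "'a set set"
  assumes "finite R" "(\<Sum>F\<in>{F\<in>\<F>. F \<subseteq> R}. 1 / real (card R choose card F)) < 1"
  obtains xs where "distinct xs" "set xs = R" "\<And>k. set (take k xs) \<notin> \<F>"
proof -
  have "\<exists>xs. distinct xs \<and> set xs = R \<and> (\<forall>k. set (take k xs) \<notin> \<F>)"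
    using assms
  proof (induction "card R" arbitrary: R)
    case 0
    then have "R = {}" by simp
    moreover have "{} \<notin> \<F>"
    proof
      assume "{} \<in> \<F>"
      then have "{F\<in>\<F>. F \<subseteq> R} = {{}}" using \<open>R = {}\<close> by auto
      with "0.prems"(2) show False using \<open>R = {}\<close> by (simp del: subset_empty)
    qed
    ultimately show ?case by simp
  next
    case (Suc m)
    have fin: "finite {F\<in>\<F>. F \<subseteq> R}"
      using Suc.prems(1) by (rule_tac finite_subset[of _ "Pow R"]) auto
    \<comment> \<open>As a member of the family, \<open>R\<close> alone would have weight 1.\<close>
    have R: "R \<notin> \<F>"
    proof
      assume "R \<in> \<F>"
      then have "(\<Sum>F\<in>{R}. 1 / real (card R choose card F))
          \<le> (\<Sum>F\<in>{F\<in>\<F>. F \<subseteq> R}. 1 / real (card R choose card F))"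
        using fin by (intro sum_mono2) auto
      with Suc.prems(2) show False by simp
    qed
    let ?g = "\<lambda>x. \<Sum>F\<in>{F\<in>\<F>. F \<subseteq> R - {x}}. 1 / real ((card R - 1) choose card F)"
    have "\<exists>x\<in>R. ?g x < 1"
    proof (rule ccontr)
      assume "\<not> (\<exists>x\<in>R. ?g x < 1)"
      then have "(\<Sum>x\<in>R. 1) \<le> sum ?g R" by (intro sum_mono) (auto simp: not_less)
      moreover have "sum ?g R = real (card R) * (\<Sum>F\<in>{F\<in>\<F>. F \<subseteq> R}. 1 / real (card R choose card F))"
        using Suc.hyps(2) R Suc.prems(1) by (intro sum_inverse_binomial_remove) auto
      moreover have "\<dots> < real (card R) * 1"
        using Suc.prems(2) Suc.hyps(2) by (intro mult_strict_left_mono) auto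
      ultimately show False by simp
    qed
    then obtain x where x: "x \<in> R" "?g x < 1" by blast
    have card: "card (R - {x}) = card R - 1" using x Suc.prems(1) by simp
    have "\<exists>xs. distinct xs \<and> set xs = R - {x} \<and> (\<forall>k. set (take k xs) \<notin> \<F>)"
    proof (rule Suc.hyps(1))
      show "m = card (R - {x})" using card Suc.hyps(2) by simp
      show "(\<Sum>F\<in>{F\<in>\<F>. F \<subseteq> R - {x}}. 1 / real (card (R - {x}) choose card F)) < 1"
        unfolding card by (rule x(2))
    qed (use Suc.prems(1) in simp)
    then obtain xs where xs: "distinct xs" "set xs = R - {x}" "\<forall>k. set (take k xs) \<notin> \<F>"
      by blast
    \<comment> \<open>Such a prefix is a prefix of \<open>xs\<close> or has all of \<open>R\<close>
      as its set.\<close>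
    have "set (take k (xs @ [x])) \<notin> \<F>" for k
      using xs x(1) R by (cases "k \<le> length xs") (auto simp: insert_absorb insert_Diff)
    then show ?case using xs x(1) by (intro exI[of _ "xs @ [x]"]) auto
  qed
  then show ?thesis using that by blast
qed

text \<open>Binomial coefficients increase up to the middle; beyond it \<open>k\<close> is replaced
  by \<open>m - k\<close>, which is still at least 2.\<close>

lemma binomial_ge_choose_two:
  assumes "2 \<le> k" "k + 2 \<le> m"
  shows "m choose 2 \<le> m choose k"
proof (cases "2 * k \<le> m")
  case True
  then show ?thesis using assms by (intro binomial_mono) auto
next
  case False
  then have "m choose 2 \<le> m choose (m - k)" using assms by (intro binomial_mono) auto
  then show ?thesis using assms by (simp add: binomial_symmetric[of k m])
qed

text \<open>The terms at 1 and \<open>m - 1\<close> contribute \<open>d / m\<close> each. The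
  \<open>m - 3\<close> terms between them are at most \<open>d / (m choose 2)\<close> each, so
  together at most \<open>2 * d / m\<close>. The total \<open>4 * d / m\<close> explains the
  constant 4.\<close>

lemma sum_inverse_binomial_less_one:
  assumes "4 * d < m"
  shows "(\<Sum>k\<in>{1..<m}. real d / real (m choose k)) < 1"
proof (cases "d = 0")
  case False
  then have m: "m \<ge> 5" using assms by simp
  have eq: "{1..<m} = insert 1 (insert (m - 1) {2..<m - 1})" using m by auto
  have "2 * (m choose 2) = m * (m - 1)" unfolding choose_two by (rule dvd_mult_div_cancel) auto
  then have "2 * real (m choose 2) = real m * real (m - 1)" by (metis of_nat_mult of_nat_numeral)
  then have b: "real (m choose 2) = real m * (real m - 1) / 2"
    using m by (simp add: of_nat_diff)
  have sym: "m choose (m - 1) = m"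
    using m binomial_symmetric[of 1 m] by simp
  have "(\<Sum>k\<in>{1..<m}. real d / real (m choose k))
      = 2 * (real d / real m) + (\<Sum>k\<in>{2..<m-1}. real d / real (m choose k))"
    unfolding eq using m sym by simp
  also have "(\<Sum>k\<in>{2..<m-1}. real d / real (m choose k)) \<le> (\<Sum>k\<in>{2..<m-1}. real d / real (m choose 2))"
  proof (rule sum_mono)
    fix k assume k: "k \<in> {2..<m-1}"
    have "m choose 2 > 0" using m by simp
    then show "real d / real (m choose k) \<le> real d / real (m choose 2)"
      using k binomial_ge_choose_two[of k m] by (intro divide_left_mono mult_pos_pos) auto
  qed
  also have "\<dots> = (real m - 3) * (real d / real (m choose 2))"
    using m by (simp add: of_nat_diff)
  also have "\<dots> \<le> 2 * (real d / real m)"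
  proof -
    have "(real m - 3) * d \<le> (real m - 1) * d" by (intro mult_right_mono) auto
    then show ?thesis unfolding b using m by (simp add: field_simps)
  qed
  finally have "(\<Sum>k\<in>{1..<m}. real d / real (m choose k)) \<le> 4 * (real d / real m)" by simp
  also have "\<dots> < 1" using assms m by (simp add: field_simps)
  finally show ?thesis .
qed simp

section \<open>Subset products and dissociated sets in abelian groups\<close>

context comm_group
begin

abbreviation set_prod :: "'a set \<Rightarrow> 'a" where
  "set_prod X \<equiv> finprod G (\<lambda>x. x) X"

lemma set_prod_closed: "X \<subseteq> carrier G \<Longrightarrow> set_prod X \<in> carrier G"
  by (rule finprod_closed) auto

lemma set_prod_insert:
  "finite X \<Longrightarrow> insert x X \<subseteq> carrier G \<Longrightarrow> x \<notin> X \<Longrightarrow> set_prod (insert x X) = set_prod X \<otimes> x"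
  by (subst finprod_insert) (auto simp: m_comm set_prod_closed)

lemma set_prod_union:
  "finite X \<Longrightarrow> finite Y \<Longrightarrow> X \<inter> Y = {} \<Longrightarrow> X \<subseteq> carrier G \<Longrightarrow> Y \<subseteq> carrier G
    \<Longrightarrow> set_prod (X \<union> Y) = set_prod X \<otimes> set_prod Y"
  by (rule finprod_Un_disjoint) auto

text \<open>By commutativity only the set of the first \<open>i\<close> elements matters. Positions
  start at 1 and list indices at 0, hence the shift \<open>k - 1\<close>.\<close>

lemma partial_sum_eq_set_prod:
  assumes "distinct xs" "set xs \<subseteq> carrier G" "i \<le> length xs"
  shows "partial_sum G (\<lambda>k. xs ! (k - 1)) i = set_prod (set (take i xs))"
  using assms(3)
proof (induction i)
  case (Suc i)
  then have i: "i < length xs" by simp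
  have "xs ! i \<notin> set (take i xs)"
    using assms(1) i by (auto simp: in_set_conv_nth nth_eq_iff_index_eq)
  moreover have "set (take (Suc i) xs) = insert (xs ! i) (set (take i xs))"
    using i by (simp add: take_Suc_conv_app_nth)
  moreover have "insert (xs ! i) (set (take i xs)) \<subseteq> carrier G"
    using assms(2) i set_take_subset[of i xs] by fastforce
  ultimately show ?case using Suc i by (simp add: set_prod_insert)
qed simp

text \<open>Equivalently, the elements satisfy no nontrivial relation with exponents in {-1, 0,
  1}.\<close>

definition dissociated :: "'a set \<Rightarrow> bool" where
  "dissociated R \<longleftrightarrow> finite R \<and> R \<subseteq> carrier G \<and> inj_on set_prod (Pow R)"

lemma dissociated_subset: "dissociated R \<Longrightarrow> S \<subseteq> R \<Longrightarrow> dissociated S"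
  unfolding dissociated_def by (auto intro: finite_subset inj_on_subset)

text \<open>In a coincidence of two subset products, \<open>x\<close> cancels if it occurs on both
  sides; if it occurs on one side only, it is a quotient of two subset products of
  \<open>R\<close>.\<close>

lemma dissociated_insert:
  assumes R: "dissociated R" and x: "x \<in> carrier G"
    and new: "x \<notin> (\<lambda>(X, Y). set_prod X \<otimes> inv set_prod Y) ` (Pow R \<times> Pow R)"
  shows "dissociated (insert x R)" "x \<notin> R"
proof -
  have fin: "finite R" and car: "R \<subseteq> carrier G" and inj: "inj_on set_prod (Pow R)"
    using R by (auto simp: dissociated_def)
  have ne: "set_prod Y \<otimes> x \<noteq> set_prod X" if XY: "X \<subseteq> R" "Y \<subseteq> R" for X Y
  proof
    assume eq: "set_prod Y \<otimes> x = set_prod X"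
    have c: "set_prod X \<in> carrier G" "set_prod Y \<in> carrier G"
      using XY car by (auto intro!: set_prod_closed)
    have "x = set_prod X \<otimes> inv set_prod Y"
      using c x eq by (metis inv_solve_right m_comm)
    then show False using new XY by force
  qed
  show xR: "x \<notin> R"
    using ne[of "{x}" "{}"] x by auto
  have ins: "set_prod (insert x X) = set_prod X \<otimes> x" if "X \<subseteq> R" for X
    using that xR x car fin by (intro set_prod_insert) (auto intro: finite_subset)
  have "inj_on set_prod (Pow (insert x R))"
  proof (rule inj_onI)
    fix X Y assume X: "X \<in> Pow (insert x R)" and Y: "Y \<in> Pow (insert x R)"
      and eq: "set_prod X = set_prod Y"
    define X' Y' where "X' = X - {x}" and "Y' = Y - {x}"
    have sub: "X' \<subseteq> R" "Y' \<subseteq> R" using X Y by (auto simp: X'_def Y'_def)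
    have X': "X = (if x \<in> X then insert x X' else X')" and Y': "Y = (if x \<in> Y then insert x Y' else Y')"
      by (auto simp: X'_def Y'_def)
    have c: "set_prod X' \<in> carrier G" "set_prod Y' \<in> carrier G"
      using sub car by (auto intro!: set_prod_closed)
    consider "x \<in> X" "x \<in> Y" | "x \<in> X" "x \<notin> Y" | "x \<notin> X" "x \<in> Y" | "x \<notin> X" "x \<notin> Y" by blast
    then show "X = Y"
    proof cases
      case 1
      then have "set_prod X' \<otimes> x = set_prod Y' \<otimes> x" using eq X' Y' ins sub by metis
      then have "X' = Y'" using c x sub inj by (auto dest: inj_onD)
      then show ?thesis using 1 X' Y' by simp
    next
      case 2
      then have "set_prod X' \<otimes> x = set_prod Y'" using eq X' Y' ins sub by metis
      then show ?thesis using ne sub by blast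
    next
      case 3
      then have "set_prod Y' \<otimes> x = set_prod X'" using eq X' Y' ins sub by metis
      then show ?thesis using ne sub by blast
    next
      case 4
      then have "X' = Y'" using eq X' Y' sub inj by (metis PowI inj_onD)
      then show ?thesis using 4 X' Y' by simp
    qed
  qed
  then show "dissociated (insert x R)" using fin car x by (simp add: dissociated_def)
qed

text \<open>Greedy choice: \<open>k\<close> chosen elements have at most
  \<open>2 ^ k * 2 ^ k = 4 ^ k\<close> quotients of subset products, so a larger \<open>A\<close>
  contains an element outside them.\<close>

lemma exists_dissociated_subset:
  assumes "A \<subseteq> carrier G" "4 ^ k \<le> card A"
  shows "\<exists>R\<subseteq>A. card R = k \<and> dissociated R"
  using assms(2)
proof (induction k)
  case 0
  then show ?case by (intro exI[of _ "{}"]) (auto simp: dissociated_def)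
next
  case (Suc k)
  then obtain R where R: "R \<subseteq> A" "card R = k" "dissociated R" by auto
  let ?B = "(\<lambda>(X, Y). set_prod X \<otimes> inv set_prod Y) ` (Pow R \<times> Pow R)"
  have fin: "finite R" using R by (simp add: dissociated_def)
  have "card ?B \<le> card (Pow R \<times> Pow R)" using fin by (intro card_image_le) auto
  also have "\<dots> = 4 ^ k" using fin R(2) by (simp add: card_cartesian_product card_Pow flip: power_mult_distrib)
  also have "\<dots> < card A" using Suc.prems by (simp add: less_le_trans[of "4^k" "4 * 4^k"])
  finally have "\<not> A \<subseteq> ?B" using fin card_mono[of ?B A] by fastforce
  then obtain x where x: "x \<in> A" "x \<notin> ?B" by blast
  then have "dissociated (insert x R)" "x \<notin> R"
    using dissociated_insert[OF R(3) _ x(2)] assms(1) by auto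
  then show ?case using R x fin by (intro exI[of _ "insert x R"]) auto
qed

end

section \<open>Admissible prefixes and their greedy extension\<close>

locale sequencing = comm_group G for G (structure) +
  fixes n d :: nat and E :: "nat set set" and A :: "'a set"
  assumes graph: "simple_graph {1..n} E"
    and degree_le: "\<And>v. v \<in> {1..n} \<Longrightarrow> degree E v \<le> d"
    and A_carrier: "A \<subseteq> carrier G" and one_notin: "\<one> \<notin> A"
    and card_A: "card A = n" and n_pos: "n > 0"
begin

lemma finite_A: "finite A"
  using card_A n_pos by (simp add: card_ge_0_finite)

definition nbrs :: "nat \<Rightarrow> nat set" where
  "nbrs v = {w. {v, w} \<in> E}"

lemma nbrs_iff: "{v, w} \<in> E \<longleftrightarrow> w \<in> nbrs v"
  by (simp add: nbrs_def)

lemma nbrs_sym: "w \<in> nbrs v \<longleftrightarrow> v \<in> nbrs w"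
  by (simp add: nbrs_def insert_commute)

lemma not_self_nbr: "v \<notin> nbrs v"
  using graph by (fastforce simp: nbrs_def simple_graph_def)

lemma nbrs_subset: "nbrs v \<subseteq> {1..n}"
  using graph by (auto simp: nbrs_def simple_graph_def)

lemma finite_nbrs: "finite (nbrs v)"
  using nbrs_subset finite_subset by blast

lemma card_nbrs_le:
  assumes "v \<in> {1..n}"
  shows "card (nbrs v) \<le> d"
proof -
  have "E \<subseteq> Pow {1..n}" using graph by (auto simp: simple_graph_def)
  then have "finite E" by (rule finite_subset) simp
  then have "card (nbrs v) \<le> card {e \<in> E. v \<in> e}"
    by (intro card_inj_on_le[where f = "\<lambda>w. {v, w}"]) (auto simp: nbrs_def inj_on_def doubleton_eq_iff)
  then show ?thesis using degree_le[OF assms] by (simp add: degree_def)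
qed

text \<open>The last partial sum does not depend on the ordering, so it is known from the start.\<close>

definition psum :: "'a list \<Rightarrow> nat \<Rightarrow> 'a" where
  "psum xs i = (if i = n then set_prod A else set_prod (set (take i xs)))"

text \<open>The case \<open>j = n\<close> settles each edge to the last vertex as soon as its other
  end is placed.\<close>

definition admissible :: "'a list \<Rightarrow> bool" where
  "admissible xs \<longleftrightarrow> distinct xs \<and> set xs \<subseteq> A \<and> length xs < n \<and>
     (\<forall>i\<in>{1..length xs}. \<forall>j\<in>nbrs i. j \<le> length xs \<or> j = n \<longrightarrow> psum xs i \<noteq> psum xs j)"

lemma psum_append: "i \<le> length xs \<or> i = n \<Longrightarrow> psum (xs @ ys) i = psum xs i"
  by (auto simp: psum_def)

lemma admissible_snoc:
  assumes "admissible xs" "x \<in> A - set xs" "Suc (length xs) < n"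
    and new: "set_prod (set xs) \<otimes> x \<notin> psum xs ` {j \<in> nbrs (Suc (length xs)). j \<le> length xs \<or> j = n}"
  shows "admissible (xs @ [x])"
proof -
  let ?k = "Suc (length xs)"
  have "set_prod (insert x (set xs)) = set_prod (set xs) \<otimes> x"
    using assms(1,2) A_carrier by (intro set_prod_insert) (auto simp: admissible_def)
  then have last: "psum (xs @ [x]) ?k = set_prod (set xs) \<otimes> x"
    using assms(3) by (simp add: psum_def)
  have ne: "psum (xs @ [x]) ?k \<noteq> psum (xs @ [x]) j" if "j \<in> nbrs ?k" "j \<le> length xs \<or> j = n" for j
    using that new psum_append[of j xs "[x]"] unfolding last by auto
  have "psum (xs @ [x]) i \<noteq> psum (xs @ [x]) j"
    if ij: "1 \<le> i" "i \<le> ?k" "j \<in> nbrs i" "j \<le> ?k \<or> j = n" for i j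
  proof -
    have "i \<noteq> j" using ij(3) not_self_nbr by auto
    then consider "i = ?k" "j \<le> length xs \<or> j = n" | "j = ?k" "i \<le> length xs"
      | "i \<le> length xs" "j \<le> length xs \<or> j = n" using ij by linarith
    then show ?thesis
    proof cases
      case 1
      then show ?thesis using ne that by simp
    next
      case 2
      then show ?thesis using ne[of i] that nbrs_sym by metis
    next
      case 3
      then show ?thesis using assms(1) that psum_append[of i xs "[x]"] psum_append[of j xs "[x]"]
        by (auto simp: admissible_def)
    qed
  qed
  then show ?thesis using assms(1,2,3) by (auto simp: admissible_def)
qed

text \<open>An injective \<open>f\<close> maps the forbidden members of \<open>W\<close> into the
  values at the at most \<open>d\<close> neighbours of \<open>v\<close>. The type of
  \<open>W\<close> is left open: it consists of group elements in the extension steps and of subsets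
  of \<open>R\<close> in the completion.\<close>

lemma card_forbidden_le:
  assumes "inj_on f W" "v \<in> {1..n}"
  shows "finite {x \<in> W. f x \<in> psum xs ` {j \<in> nbrs v. T j}}"
    and "card {x \<in> W. f x \<in> psum xs ` {j \<in> nbrs v. T j}} \<le> d"
proof -
  let ?B = "{x \<in> W. f x \<in> psum xs ` {j \<in> nbrs v. T j}}"
  have inj: "inj_on f ?B" using assms(1) by (auto intro: inj_on_subset)
  have sub: "f ` ?B \<subseteq> psum xs ` nbrs v" by auto
  then show "finite ?B" using inj finite_nbrs by (meson finite_imageD finite_imageI finite_subset)
  have "card ?B \<le> card (psum xs ` nbrs v)"
    using inj sub finite_nbrs by (intro card_inj_on_le) auto
  also have "\<dots> \<le> d" using card_image_le[OF finite_nbrs] card_nbrs_le[OF assms(2)] le_trans by blast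
  finally show "card ?B \<le> d" .
qed

lemma extend_one:
  assumes "admissible xs" "Suc (length xs) < n" "W \<subseteq> A - set xs" "d < card W"
  obtains x where "x \<in> W" "admissible (xs @ [x])"
proof -
  let ?B = "{x \<in> W. set_prod (set xs) \<otimes> x \<in> psum xs ` {j \<in> nbrs (Suc (length xs)). j \<le> length xs \<or> j = n}}"
  have c: "set_prod (set xs) \<in> carrier G"
    using assms(1) A_carrier by (intro set_prod_closed) (auto simp: admissible_def)
  have "inj_on (\<lambda>x. set_prod (set xs) \<otimes> x) W"
    using c assms(3) A_carrier by (intro inj_onI) (metis Diff_iff Units_eq Units_l_cancel subsetD)
  from card_forbidden_le[OF this, of "Suc (length xs)"] have "finite ?B" "card ?B \<le> d"
    using assms(2) by auto
  then have "\<not> W \<subseteq> ?B" using assms(4) card_mono[of ?B W] by fastforce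
  then obtain x where "x \<in> W" "x \<notin> ?B" by blast
  then show ?thesis using that[of x] admissible_snoc[OF assms(1) _ assms(2)] assms(3) by blast
qed

text \<open>A prescribed element \<open>q\<close> is placed by choosing its predecessor \<open>x\<close>. The constraint between
  the two new positions holds for every \<open>x\<close> because \<open>q \<noteq> \<one>\<close>.\<close>

lemma extend_two:
  assumes "admissible xs" "Suc (Suc (length xs)) < n" "W \<subseteq> A - set xs" "2 * d < card W"
    and q: "q \<in> A - set xs" "q \<notin> W"
  obtains x where "x \<in> W" "admissible (xs @ [x, q])"
proof -
  let ?l = "length xs" and ?p = "set_prod (set xs)"
  \<comment> \<open>\<open>?B\<close> collects the \<open>x\<close> that fail at the position of
    \<open>x\<close>, \<open>?C\<close> those that fail at the position of \<open>q\<close>. Each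
    has at most \<open>d\<close> members, hence the bound \<open>2 * d\<close>.\<close>
  let ?B = "{x \<in> W. ?p \<otimes> x \<in> psum xs ` {j \<in> nbrs (Suc ?l). j \<le> ?l \<or> j = n}}"
  let ?C = "{x \<in> W. ?p \<otimes> x \<otimes> q \<in> psum xs ` {j \<in> nbrs (Suc (Suc ?l)). j \<le> ?l \<or> j = n}}"
  have c: "?p \<in> carrier G"
    using assms(1) A_carrier by (intro set_prod_closed) (auto simp: admissible_def)
  have qc: "q \<in> carrier G" using q A_carrier by auto
  have WA: "x \<in> carrier G" if "x \<in> W" for x using that assms(3) A_carrier by auto
  have "inj_on (\<lambda>x. ?p \<otimes> x) W" using c WA by (intro inj_onI) simp
  from card_forbidden_le[OF this, of "Suc ?l"] have B: "finite ?B" "card ?B \<le> d"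
    using assms(2) by auto
  have "inj_on (\<lambda>x. ?p \<otimes> x \<otimes> q) W" using c qc WA by (intro inj_onI) simp
  from card_forbidden_le[OF this, of "Suc (Suc ?l)"] have C: "finite ?C" "card ?C \<le> d"
    using assms(2) by auto
  have "card (?B \<union> ?C) \<le> 2 * d" using card_Un_le[of ?B ?C] B C by linarith
  then have "\<not> W \<subseteq> ?B \<union> ?C" using assms(4) B C card_mono[of "?B \<union> ?C" W] by fastforce
  then obtain x where x: "x \<in> W" "x \<notin> ?B" "x \<notin> ?C" by blast
  have ax: "admissible (xs @ [x])"
    using x assms(1-3) by (intro admissible_snoc) auto
  have px: "set_prod (set (xs @ [x])) = ?p \<otimes> x"
    using x(1) assms(1,3) A_carrier by (simp, intro set_prod_insert) (auto simp: admissible_def)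
  have "admissible ((xs @ [x]) @ [q])"
  proof (rule admissible_snoc[OF ax])
    show "q \<in> A - set (xs @ [x])" using q x by auto
    show "Suc (length (xs @ [x])) < n" using assms(2) by simp
    have "?p \<otimes> x \<otimes> q \<noteq> psum (xs @ [x]) j"
      if j: "j \<in> nbrs (Suc (Suc ?l))" "j \<le> Suc ?l \<or> j = n" for j
    proof (cases "j = Suc ?l")
      case True
      then have "psum (xs @ [x]) j = ?p \<otimes> x" using px assms(2) by (simp add: psum_def)
      moreover have "?p \<otimes> x \<otimes> q \<noteq> ?p \<otimes> x"
        using c qc WA[OF x(1)] one_notin q by auto
      ultimately show ?thesis by simp
    next
      case False
      then have "j \<le> ?l \<or> j = n" using j by linarith
      then show ?thesis using x j psum_append[of j xs "[x]"] by auto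
    qed
    then show "set_prod (set (xs @ [x])) \<otimes> q \<notin> psum (xs @ [x]) `
        {j \<in> nbrs (Suc (length (xs @ [x]))). j \<le> length (xs @ [x]) \<or> j = n}"
      unfolding px by auto
  qed
  then show ?thesis using that[of x] x by simp
qed

text \<open>Induction on the number of unreserved elements \<open>Q\<close>. While more than
  \<open>d\<close> remain, \<open>Q\<close> itself offers enough candidates. Each of the last ones
  is placed after an element of \<open>R\<close>, and \<open>min (card Q) d\<close> counts the
  reserved elements still to be spent in this way.\<close>

lemma reduce_to_dissociated:
  assumes "admissible xs" "dissociated R" "Q \<inter> R = {}" "A - set xs = Q \<union> R"
    and "4 * d + min (card Q) d < card R" "d > 0"
  shows "\<exists>ys R'. admissible ys \<and> dissociated R' \<and> A - set ys = R' \<and> 4 * d < card R'"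
  using assms
proof (induction "card Q" arbitrary: xs Q R rule: less_induct)
  case less
  have fin: "finite Q" "finite R" using less.prems(4) finite_A by (metis finite_Diff finite_Un)+
  have "distinct xs" "set xs \<subseteq> A" using less.prems(1) by (auto simp: admissible_def)
  then have "card (A - set xs) = n - length xs" "length xs \<le> n"
    using finite_A card_A card_mono[of A "set xs"]
    by (auto simp: card_Diff_subset distinct_card)
  moreover have "card (A - set xs) = card Q + card R"
    unfolding less.prems(4) using fin less.prems(3) by (rule card_Un_disjoint)
  ultimately have len: "length xs + card Q + card R = n" by linarith
  consider "Q = {}" | "Q \<noteq> {}" "card Q \<le> d" | "d < card Q" by fastforce
  then show ?case
  proof cases
    case 1
    then show ?thesis using less.prems by auto
  next
    case 2
    then obtain q where q: "q \<in> Q" by blast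
    then have "card Q > 0" using fin by (auto simp: card_gt_0_iff)
    obtain x where x: "x \<in> R" "admissible (xs @ [x, q])"
      using len less.prems q by (elim extend_two[of xs R q]) auto
    show ?thesis
    proof (rule less.hyps[of "Q - {q}" "xs @ [x, q]" "R - {x}"])
      show "card (Q - {q}) < card Q" using q fin by (meson card_Diff1_less)
      show "dissociated (R - {x})" using less.prems(2) by (rule dissociated_subset) auto
      \<comment> \<open>Since \<open>card Q \<le> d\<close>, both sides drop by one.\<close>
      show "4 * d + min (card (Q - {q})) d < card (R - {x})"
        using less.prems(5) 2 q x fin \<open>card Q > 0\<close> by simp
      show "A - set (xs @ [x, q]) = (Q - {q}) \<union> (R - {x})"
        using less.prems(3,4) q x by auto
    qed (use x less.prems in auto)
  next
    case 3
    obtain q where q: "q \<in> Q" "admissible (xs @ [q])"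
      using len less.prems 3 by (elim extend_one[of xs Q]) auto
    show ?thesis
    proof (rule less.hyps[of "Q - {q}" "xs @ [q]" R])
      show "card (Q - {q}) < card Q" using q fin by (meson card_Diff1_less)
      \<comment> \<open>At least \<open>d\<close> elements of \<open>Q\<close> remain, so the
        minimum is still \<open>d\<close>.\<close>
      show "4 * d + min (card (Q - {q})) d < card R"
        using less.prems(5) 3 q fin by simp
      show "A - set (xs @ [q]) = (Q - {q}) \<union> R"
        using less.prems(3,4) q by auto
    qed (use q less.prems in auto)
  qed
qed

section \<open>Completion by an ordering of the reserved elements\<close>

text \<open>With \<open>b = length ys\<close>, an edge with one end in \<open>{1..b}\<close> and the
  other in \<open>{1..b}\<close> or equal to \<open>n\<close> is covered by admissibility, and one
  with both ends beyond \<open>b\<close> by dissociation. Edges from \<open>{1..b}\<close> to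
  positions strictly between \<open>b\<close> and \<open>n\<close> are handled by the union
  bound.\<close>

lemma complete_with_dissociated:
  assumes ys: "admissible ys" and R: "dissociated R" "A - set ys = R" "4 * d < card R"
  obtains xs where "distinct xs" "set xs = A"
    "\<And>i j. i \<in> {1..n} \<Longrightarrow> j \<in> nbrs i \<Longrightarrow> psum xs i \<noteq> psum xs j"
proof -
  define b m where "b = length ys" and "m = card R"
  have dist: "distinct ys" "set ys \<subseteq> A" using ys by (auto simp: admissible_def)
  then have "card R = n - b" "b \<le> n"
    using R(2) finite_A card_A card_mono[of A "set ys"]
    by (auto simp: card_Diff_subset distinct_card b_def)
  then have n: "n = b + m" unfolding m_def by simp
  have fin: "finite R" and RG: "R \<subseteq> carrier G" and inj: "inj_on set_prod (Pow R)"
    using R(1) by (auto simp: dissociated_def)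
  let ?p = "set_prod (set ys)"
  have pc: "?p \<in> carrier G" using dist A_carrier by (intro set_prod_closed) auto
  have cancel: "J = K" if "J \<subseteq> R" "K \<subseteq> R" "?p \<otimes> set_prod J = ?p \<otimes> set_prod K" for J K
  proof -
    have "set_prod J \<in> carrier G" "set_prod K \<in> carrier G"
      using that RG by (auto intro!: set_prod_closed)
    then have "set_prod J = set_prod K" using that(3) pc by simp
    then show ?thesis using inj that by (auto dest: inj_onD)
  qed
  \<comment> \<open>These \<open>J\<close>, as the set of the first \<open>k\<close> reserved
    elements, would make position \<open>b + k\<close> collide with a neighbour in the prefix. By
    \<open>cancel\<close>, distinct \<open>J\<close> give distinct values, so at most
    \<open>d\<close> of them are bad.\<close>
  define bad where "bad k = {J \<in> {J. J \<subseteq> R \<and> card J = k}. ?p \<otimes> set_prod J \<in> psum ys ` {j \<in> nbrs (b + k). j \<le> b}}" for k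
  have bad: "finite (bad k)" "card (bad k) \<le> d" if "k \<in> {1..<m}" for k
  proof -
    have "inj_on (\<lambda>J. ?p \<otimes> set_prod J) {J. J \<subseteq> R \<and> card J = k}"
      by (intro inj_onI cancel) auto
    from card_forbidden_le[OF this, of "b + k"] show "finite (bad k)" "card (bad k) \<le> d"
      unfolding bad_def using that n by auto
  qed
  \<comment> \<open>The ends \<open>k = 0\<close> and \<open>k = m\<close> are left out: they are
    the positions \<open>b\<close> and \<open>n\<close>, covered by admissibility.\<close>
  define \<F> where "\<F> = (\<Union>k\<in>{1..<m}. bad k)"
  have "{F\<in>\<F>. F \<subseteq> R} = \<F>" by (auto simp: \<F>_def bad_def)
  then have "(\<Sum>F\<in>{F\<in>\<F>. F \<subseteq> R}. 1 / real (card R choose card F))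
      = (\<Sum>F\<in>(\<Union>k\<in>{1..<m}. bad k). 1 / real (m choose card F))"
    by (simp add: \<F>_def m_def)
  \<comment> \<open>The families \<open>bad k\<close> are disjoint, as their members have size
    \<open>k\<close>.\<close>
  also have "\<dots> = (\<Sum>k\<in>{1..<m}. \<Sum>F\<in>bad k. 1 / real (m choose card F))"
    using bad by (intro sum.UNION_disjoint) (auto simp: bad_def)
  also have "\<dots> = (\<Sum>k\<in>{1..<m}. real (card (bad k)) / real (m choose k))"
    by (intro sum.cong refl) (simp add: bad_def)
  also have "\<dots> \<le> (\<Sum>k\<in>{1..<m}. real d / real (m choose k))"
    using bad by (intro sum_mono divide_right_mono) auto
  also have "\<dots> < 1" using R(3) by (intro sum_inverse_binomial_less_one) (simp add: m_def)
  finally obtain zs where zs: "distinct zs" "set zs = R" "\<And>k. set (take k zs) \<notin> \<F>"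
    using chain_avoiding_family[OF fin] by blast
  have lz: "length zs = m" using zs by (auto simp: m_def dest: distinct_card)
  define xs where "xs = ys @ zs"
  have dx: "distinct xs" and sx: "set xs = A"
    using zs R(2) dist by (auto simp: xs_def)
  have lo: "psum xs i = psum ys i" if "i \<le> b \<or> i = n" for i
    using that by (simp add: xs_def b_def psum_append)
  have hi: "psum xs (b + k) = ?p \<otimes> set_prod (set (take k zs))" if "k \<le> m" for k
  proof -
    have "set (take k zs) \<subseteq> R" using zs(2) set_take_subset by metis
    then have "set_prod (set ys \<union> set (take k zs)) = ?p \<otimes> set_prod (set (take k zs))"
      using R(2) dist A_carrier RG by (intro set_prod_union) auto
    \<comment> \<open>For \<open>k = m\<close> the position is \<open>n\<close>, where
      \<open>psum\<close> is \<open>set_prod A\<close> by definition and all of \<open>R\<close> has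
      been placed.\<close>
    moreover have "psum xs (b + k) = set_prod (set ys \<union> set (take k zs))"
      using sx lz n unfolding psum_def by (cases "k = m") (auto simp: xs_def b_def)
    ultimately show ?thesis by simp
  qed
  have main: "psum xs i \<noteq> psum xs j" if ij: "i \<in> {1..n}" "j \<in> nbrs i" "i < j" for i j
  proof -
    have jn: "j \<le> n" using ij nbrs_subset[of i] by auto
    consider "j \<le> b \<or> j = n" "i \<le> b" | "i \<le> b" "b < j" "j < n" | "b < i" using jn by linarith
    then show ?thesis
    proof cases
      case 1
      then show ?thesis using ys ij lo by (auto simp: admissible_def b_def)
    next
      case 2
      define k where "k = j - b"
      have k: "j = b + k" "k \<in> {1..<m}" using 2 n by (auto simp: k_def)
      show ?thesis
      proof
        assume "psum xs i = psum xs j"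
        then have "?p \<otimes> set_prod (set (take k zs)) = psum ys i" using hi[of k] lo[of i] k 2 by simp
        moreover have "i \<in> nbrs (b + k)" using ij(2) k(1) nbrs_sym by simp
        moreover have "set (take k zs) \<subseteq> R" using zs(2) set_take_subset by metis
        moreover have "card (set (take k zs)) = k"
          using zs(1) lz k by (simp add: distinct_card)
        ultimately have "set (take k zs) \<in> bad k" using 2 unfolding bad_def by auto
        then show False using zs(3)[of k] k by (auto simp: \<F>_def)
      qed
    next
      case 3
      define k l where "k = i - b" and "l = j - b"
      have kl: "i = b + k" "j = b + l" "k < l" "l \<le> m" using 3 ij(3) jn n by (auto simp: k_def l_def)
      show ?thesis
      proof
        assume "psum xs i = psum xs j"
        then have "?p \<otimes> set_prod (set (take k zs)) = ?p \<otimes> set_prod (set (take l zs))"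
          using hi[of k] hi[of l] kl by simp
        moreover have "set (take k zs) \<subseteq> R" "set (take l zs) \<subseteq> R" using zs(2) set_take_subset by metis+
        ultimately have "set (take k zs) = set (take l zs)" by (intro cancel)
        then have "card (set (take k zs)) = card (set (take l zs))" by simp
        then show False using zs(1) lz kl by (simp add: distinct_card)
      qed
    qed
  qed
  have "psum xs i \<noteq> psum xs j" if ij: "i \<in> {1..n}" "j \<in> nbrs i" for i j
  proof (cases "i < j")
    case True
    then show ?thesis using main ij by blast
  next
    case False
    then have "j < i" using ij not_self_nbr by (metis linorder_neqE_nat)
    then show ?thesis using main[of j i] ij nbrs_subset[of i] nbrs_sym[of j i] by fastforce
  qed
  then show ?thesis using that dx sx by blast
qed

text \<open>Of the \<open>5 * d + 1\<close> reserved elements at most \<open>d\<close> are spent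
  before the completion, which leaves more than \<open>4 * d\<close>.\<close>

theorem graph_sequenceable_of_large:
  assumes "d > 0" "4 ^ (5 * d + 1) \<le> n"
  shows "graph_sequenceable G n E A"
proof -
  obtain R where R: "R \<subseteq> A" "card R = 5 * d + 1" "dissociated R"
    using exists_dissociated_subset[OF A_carrier] assms(2) card_A by blast
  have "\<exists>ys R'. admissible ys \<and> dissociated R' \<and> A - set ys = R' \<and> 4 * d < card R'"
    by (rule reduce_to_dissociated[of "[]" R "A - R"])
       (use R assms(1) n_pos in \<open>auto simp: admissible_def\<close>)
  then obtain ys R' where "admissible ys" "dissociated R'" "A - set ys = R'" "4 * d < card R'" by blast
  then obtain xs where xs: "distinct xs" "set xs = A"
    and ne: "\<And>i j. i \<in> {1..n} \<Longrightarrow> j \<in> nbrs i \<Longrightarrow> psum xs i \<noteq> psum xs j"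
    by (rule complete_with_dissociated) blast
  have len: "length xs = n" using xs card_A by (auto dest: distinct_card)
  let ?v = "\<lambda>k. xs ! (k - 1)"
  have "bij_betw ?v {1..n} A"
  proof -
    have "bij_betw (\<lambda>k. k - 1) {1..n} {..<n}"
      by (rule bij_betw_byWitness[where f' = Suc]) auto
    from bij_betw_trans[OF this] bij_betw_nth[OF xs(1) refl xs(2)[symmetric]] show ?thesis
      by (auto simp: comp_def len)
  qed
  \<comment> \<open>At \<open>i = n\<close> the prefix is all of \<open>xs\<close>, so the value
    fixed in advance is the true one.\<close>
  moreover have "partial_sum G ?v i = psum xs i" if "i \<in> {1..n}" for i
    using that xs len A_carrier partial_sum_eq_set_prod[of xs i] by (auto simp: psum_def)
  then have "\<forall>i\<in>{1..n}. \<forall>j\<in>{1..n}. {i, j} \<in> E \<longrightarrow> partial_sum G ?v i \<noteq> partial_sum G ?v j"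
    using ne by (simp add: nbrs_iff)
  ultimately show ?thesis using A_carrier by (auto simp: graph_sequenceable_def)
qed

end

theorem theorem5p4:
  shows "\<forall>d::nat. d > 0 \<longrightarrow> (\<exists>N::nat. \<forall>n\<ge>N. \<forall>E :: nat set set.
    simple_graph {1..n} E \<and> max_degree {1..n} E \<le> d \<longrightarrow>
    (\<forall>p::nat. prime p \<and> p > n^2 \<longrightarrow>
      (\<forall>A. A \<subseteq> carrier (integer_mod_group p) - {0} \<and> card A = n \<longrightarrow>
        graph_sequenceable (integer_mod_group p) n E A)))"
proof (intro allI impI)
  fix d :: nat assume d: "d > 0"
  show "\<exists>N::nat. \<forall>n\<ge>N. \<forall>E :: nat set set.
    simple_graph {1..n} E \<and> max_degree {1..n} E \<le> d \<longrightarrow>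
    (\<forall>p::nat. prime p \<and> p > n^2 \<longrightarrow>
      (\<forall>A. A \<subseteq> carrier (integer_mod_group p) - {0} \<and> card A = n \<longrightarrow>
        graph_sequenceable (integer_mod_group p) n E A))"
  proof (intro exI[of _ "4 ^ (5 * d + 1)"] allI impI, elim conjE)
    fix n p :: nat and E :: "nat set set" and A
    assume n: "4 ^ (5 * d + 1) \<le> n" and E: "simple_graph {1..n} E" "max_degree {1..n} E \<le> d"
      and A: "A \<subseteq> carrier (integer_mod_group p) - {0}" "card A = n"
    have "(0::nat) < 4 ^ (5 * d + 1)" by simp
    then have "n > 0" using n by linarith
    interpret comm_group "integer_mod_group p"
      by (rule abelian_integer_mod_group)
    interpret sequencing "integer_mod_group p" n d E A
    proof
      show "degree E v \<le> d" if "v \<in> {1..n}" for v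
      proof -
        have "degree E v \<le> max_degree {1..n} E"
          unfolding max_degree_def using that by (intro Max_ge) auto
        then show ?thesis using E(2) by simp
      qed
    qed (use A E(1) \<open>n > 0\<close> in auto)
    show "graph_sequenceable (integer_mod_group p) n E A"
      using d n by (rule graph_sequenceable_of_large)
  qed
qed

end
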